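(* Let $X_i = U_i Z_i^T\in\mathbb{R}^{m\times n}$ have rank $r$, with $U_i\in\mathbb{R}^{m\times r}$, $U_i^TU_i=I$, and $Z_i\in\mathbb{R}^{n\times r}$ of rank $r$; let $\overline{L}\in\mathbb{R}^{m\times n}$ and $\Delta t\in\mathbb{R}$. Let $X_{i+1} = \mathcal{R}^{\mathrm{opt}}_{X_i}(\Delta t\,\overline{L})$ be the result of applying the optimal perturbative retraction of any order $p\in\{1,2,3,4\}$. Then $$\|X_{i+1}\| \le \|X_i + \Delta t\,\overline{L}\|.$$
   Context: $\|\cdot\|$ is the Frobenius norm. Write $U=U_i$, $Z=Z_i$, $L=\overline{L}$, $P^\perp = I-UU^T$. The corrections $\dot U_1,\dots,\dot U_4\in\mathbb{R}^{m\times r}$ are $$\dot U_1 = P^\perp L Z (Z^TZ)^{-1},$$ $$\dot U_2 = \left[P^\perp LL^TU - \dot U_1(U^TLZ+Z^TL^TU)\right](Z^TZ)^{-1},$$ $$\dot U_3 = \left[P^\perp LL^T\dot U_1 - \dot U_2(U^TLZ+Z^TL^TU) - \dot U_1(U^TLL^TU+\dot U_1^TLZ+Z^TL^T\dot U_1-\dot U_1^T\dot U_1Z^TZ)\right](Z^TZ)^{-1},$$ $$\begin{aligned}\dot U_4 = \big[&P^\perp LL^T\dot U_2 - \dot U_3(U^TLZ+Z^TL^TU) - \dot U_2(U^TLL^TU+\dot U_1^TLZ+Z^TL^T\dot U_1-\dot U_1^T\dot U_1Z^TZ)\\ &-\dot U_1(U^TLL^T\dot U_1+\dot U_1^TLL^TU+\dot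 U_2^TLZ+Z^TL^T\dot U_2-\dot U_1^T\dot U_2Z^TZ-\dot U_2^T\dot U_1Z^TZ\\ &\qquad-\dot U_1^T\dot U_1U^TLZ-\dot U_1^T\dot U_1Z^TL^TU)\big](Z^TZ)^{-1}.\end{aligned}$$ The optimal perturbative retraction of order $p$ is $\mathcal{R}^{\mathrm{opt}}_{X_i}(\Delta t\,\overline{L}) = U_{i+1}Z_{i+1}^T$, where $$U_{i+1} = \mathrm{orth}\Big(U_i+\sum_{j=1}^p\Delta t^j\dot U_j\Big),\qquad Z_{i+1} = (X_i+\Delta t\,\overline{L})^TU_{i+1}.$$ Here $\mathrm{orth}(A)$, for $A\in\mathbb{R}^{m\times r}$ of full column rank, denotes a matrix $AG$ with $G\in\mathbb{R}^{r\times r}$ invertible and $(AG)^T(AG)=I$ (e.g. from a QR decomposition). *)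

theory Defs
  imports "HOL-Analysis.Analysis"
begin

text \<open>
  A real \<open>m \<times> n\<close> matrix is an element of \<^typ>\<open>real^'n^'m\<close> with \<open>m = CARD('m)\<close>
  and \<open>n = CARD('n)\<close>.
\<close>

notation transpose ("(_\<^sup>T)" [1000] 999)

text \<open>The library norm on \<^typ>\<open>real^'n^'m\<close>, taken row by row, is the Frobenius norm.\<close>

lemma norm_eq_Frobenius:
  fixes A :: "real^'n^'m"
  shows "norm A = sqrt (\<Sum>i\<in>UNIV. \<Sum>j\<in>UNIV. (A $ i $ j)\<^sup>2)"
  by (simp add: norm_vec_def L2_set_def sum_nonneg)

definition Pperp :: "real^'r^'m \<Rightarrow> real^'m^'m" where
  "Pperp U = mat 1 - U ** U\<^sup>T"

definition dU1 :: "real^'r^'m \<Rightarrow> real^'r^'n \<Rightarrow> real^'n^'m \<Rightarrow> real^'r^'m" where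
  "dU1 U Z L = Pperp U ** L ** Z ** matrix_inv (Z\<^sup>T ** Z)"

definition dU2 :: "real^'r^'m \<Rightarrow> real^'r^'n \<Rightarrow> real^'n^'m \<Rightarrow> real^'r^'m" where
  "dU2 U Z L =
    (let U1 = dU1 U Z L in
      (Pperp U ** L ** L\<^sup>T ** U
       - U1 ** (U\<^sup>T ** L ** Z + Z\<^sup>T ** L\<^sup>T ** U))
      ** matrix_inv (Z\<^sup>T ** Z))"

definition dU3 :: "real^'r^'m \<Rightarrow> real^'r^'n \<Rightarrow> real^'n^'m \<Rightarrow> real^'r^'m" where
  "dU3 U Z L =
    (let U1 = dU1 U Z L; U2 = dU2 U Z L in
      (Pperp U ** L ** L\<^sup>T ** U1
       - U2 ** (U\<^sup>T ** L ** Z + Z\<^sup>T ** L\<^sup>T ** U)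
       - U1 ** (U\<^sup>T ** L ** L\<^sup>T ** U + U1\<^sup>T ** L ** Z + Z\<^sup>T ** L\<^sup>T ** U1
                - U1\<^sup>T ** U1 ** Z\<^sup>T ** Z))
      ** matrix_inv (Z\<^sup>T ** Z))"

definition dU4 :: "real^'r^'m \<Rightarrow> real^'r^'n \<Rightarrow> real^'n^'m \<Rightarrow> real^'r^'m" where
  "dU4 U Z L =
    (let U1 = dU1 U Z L; U2 = dU2 U Z L; U3 = dU3 U Z L in
      (Pperp U ** L ** L\<^sup>T ** U2
       - U3 ** (U\<^sup>T ** L ** Z + Z\<^sup>T ** L\<^sup>T ** U)
       - U2 ** (U\<^sup>T ** L ** L\<^sup>T ** U + U1\<^sup>T ** L ** Z + Z\<^sup>T ** L\<^sup>T ** U1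
                - U1\<^sup>T ** U1 ** Z\<^sup>T ** Z)
       - U1 ** (U\<^sup>T ** L ** L\<^sup>T ** U1 + U1\<^sup>T ** L ** L\<^sup>T ** U
                + U2\<^sup>T ** L ** Z + Z\<^sup>T ** L\<^sup>T ** U2
                - U1\<^sup>T ** U2 ** Z\<^sup>T ** Z - U2\<^sup>T ** U1 ** Z\<^sup>T ** Z
                - U1\<^sup>T ** U1 ** U\<^sup>T ** L ** Z - U1\<^sup>T ** U1 ** Z\<^sup>T ** L\<^sup>T ** U))
      ** matrix_inv (Z\<^sup>T ** Z))"

text \<open>The corrections are only defined for \<open>1 \<le> j \<le> 4\<close>; the value \<open>0\<close> elsewhere is arbitrary.\<close>

definition correction ::
    "nat \<Rightarrow> real^'r^'m \<Rightarrow> real^'r^'n \<Rightarrow> real^'n^'m \<Rightarrow> real^'r^'m" where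
  "correction j U Z L =
    (if j = 1 then dU1 U Z L else if j = 2 then dU2 U Z L
     else if j = 3 then dU3 U Z L else if j = 4 then dU4 U Z L else 0)"

text \<open>
  The orthonormalised factor \<open>orth A\<close> is not unique, so the retraction takes the
  orthonormalisation procedure as a parameter. Nothing is assumed about its value on
  matrices without full column rank.
\<close>

definition is_orth :: "(real^'r^'m \<Rightarrow> real^'r^'m) \<Rightarrow> bool" where
  "is_orth orth \<longleftrightarrow>
    (\<forall>A :: real^'r^'m. rank A = CARD('r) \<longrightarrow>
      (\<exists>G :: real^'r^'r. invertible G \<and> orth A = A ** G \<and> (A ** G)\<^sup>T ** (A ** G) = mat 1))"

definition next_U ::
    "(real^'r^'m \<Rightarrow> real^'r^'m) \<Rightarrow> nat \<Rightarrow> real^'r^'m \<Rightarrow> real^'r^'n \<Rightarrow> real \<Rightarrow> real^'n^'m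
      \<Rightarrow> real^'r^'m" where
  "next_U orth p U Z dt L = orth (U + (\<Sum>j=1..p. dt ^ j *\<^sub>R correction j U Z L))"

definition next_Z ::
    "(real^'r^'m \<Rightarrow> real^'r^'m) \<Rightarrow> nat \<Rightarrow> real^'r^'m \<Rightarrow> real^'r^'n \<Rightarrow> real \<Rightarrow> real^'n^'m
      \<Rightarrow> real^'r^'n" where
  "next_Z orth p U Z dt L = (U ** Z\<^sup>T + dt *\<^sub>R L)\<^sup>T ** next_U orth p U Z dt L"

text \<open>
  The order-\<open>p\<close> optimal perturbative retraction of \<open>dt *\<^sub>R L\<close> at the point \<open>X = U ** Z\<^sup>T\<close>,
  which is given by its factors.
\<close>

definition opt_retraction ::
    "(real^'r^'m \<Rightarrow> real^'r^'m) \<Rightarrow> nat \<Rightarrow> real^'r^'m \<Rightarrow> real^'r^'n \<Rightarrow> real \<Rightarrow> real^'n^'m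
      \<Rightarrow> real^'n^'m" where
  "opt_retraction orth p U Z dt L = next_U orth p U Z dt L ** (next_Z orth p U Z dt L)\<^sup>T"

end

theory Submission
  imports Defs
begin

text \<open>
  Every correction has columns orthogonal to those of \<open>U\<close>, because each is obtained by
  projecting with \<open>I - U U\<^sup>T\<close>, subtracting right multiples of earlier corrections and
  multiplying from the right.
  So \<open>A = U + \<Sum>\<^sub>j dt\<^sup>j dU\<^sub>j\<close> satisfies \<open>U\<^sup>T A = U\<^sup>T U = I\<close>. Having a left inverse,
  \<open>A\<close> has full column rank whatever the size of \<open>dt\<close>, and \<open>orth\<close> therefore returns a matrix \<open>Q\<close>
  with orthonormal columns. Substituting the second factor into the first shows that the
  retraction is \<open>Q Q\<^sup>T (X + dt L)\<close>, an orthogonal projection of \<open>X + dt L\<close>,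
  and orthogonal projections do not increase the Frobenius norm.
\<close>

lemma inner_matrix_mult_left:
  fixes A :: "real^'k^'m" and B :: "real^'n^'k" and C :: "real^'n^'m"
  shows "(A ** B) \<bullet> C = B \<bullet> (A\<^sup>T ** C)"
proof -
  have "(A ** B) \<bullet> C = (\<Sum>i\<in>UNIV. \<Sum>j\<in>UNIV. \<Sum>k\<in>UNIV. A$i$k * B$k$j * C$i$j)"
    by (simp add: inner_vec_def matrix_matrix_mult_def sum_distrib_right)
  also have "\<dots> = (\<Sum>i\<in>UNIV. \<Sum>k\<in>UNIV. \<Sum>j\<in>UNIV. A$i$k * B$k$j * C$i$j)"
    by (intro sum.cong refl sum.swap)
  also have "\<dots> = (\<Sum>k\<in>UNIV. \<Sum>i\<in>UNIV. \<Sum>j\<in>UNIV. A$i$k * B$k$j * C$i$j)"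
    by (rule sum.swap)
  also have "\<dots> = (\<Sum>k\<in>UNIV. \<Sum>j\<in>UNIV. \<Sum>i\<in>UNIV. A$i$k * B$k$j * C$i$j)"
    by (intro sum.cong refl sum.swap)
  also have "\<dots> = B \<bullet> (A\<^sup>T ** C)"
    by (simp add: inner_vec_def matrix_matrix_mult_def transpose_def sum_distrib_left mult_ac)
  finally show ?thesis .
qed

text \<open>
  With \<open>P = Q Q\<^sup>T\<close>, idempotence and symmetry give \<open>\<parallel>P Y\<parallel>\<^sup>2 = \<langle>Y, P Y\<rangle>\<close>, which
  Cauchy-Schwarz bounds by \<open>\<parallel>Y\<parallel> \<parallel>P Y\<parallel>\<close>.
\<close>

lemma norm_orthonormal_projection_le:
  fixes Q :: "real^'r^'m" and Y :: "real^'n^'m"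
  assumes "Q\<^sup>T ** Q = mat 1"
  shows "norm (Q ** (Q\<^sup>T ** Y)) \<le> norm Y"
proof -
  let ?P = "Q ** (Q\<^sup>T ** Y)"
  have "?P \<bullet> ?P = (Q\<^sup>T ** Y) \<bullet> (Q\<^sup>T ** Y)"
    by (subst inner_matrix_mult_left) (simp add: matrix_mul_assoc assms)
  also have "\<dots> = Y \<bullet> ?P"
    by (subst inner_matrix_mult_left) simp
  also have "\<dots> \<le> norm Y * norm ?P"
    by (rule norm_cauchy_schwarz)
  finally have "norm ?P * norm ?P \<le> norm Y * norm ?P"
    by (simp flip: power2_norm_eq_inner add: power2_eq_square)
  then show ?thesis
    by (cases "norm ?P = 0") (simp_all add: mult_le_cancel_right)
qed

lemma rank_eq_card_of_left_inverse:
  fixes A :: "real^'r^'m"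
  assumes "B ** A = mat 1"
  shows "rank A = CARD('r)"
  using assms by (metis full_rank_injective matrix_left_invertible_injective)

lemma matrix_diff_ldistrib:
  fixes A :: "real^'k^'m" and B C :: "real^'n^'k"
  shows "A ** (B - C) = A ** B - A ** C"
  by (simp add: vec_eq_iff matrix_matrix_mult_def right_diff_distrib sum_subtractf)

lemma matrix_scaleR_right:
  fixes A :: "real^'k^'m" and B :: "real^'n^'k"
  shows "A ** (c *\<^sub>R B) = c *\<^sub>R (A ** B)"
  by (simp add: vec_eq_iff matrix_matrix_mult_def sum_distrib_left mult_ac)

lemma transpose_mult_Pperp:
  fixes U :: "real^'r^'m"
  assumes "U\<^sup>T ** U = mat 1"
  shows "U\<^sup>T ** Pperp U = 0"
  by (simp add: Pperp_def matrix_diff_ldistrib matrix_mul_assoc assms)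

text \<open>
  The leading term of each correction starts with the factor \<open>I - U U\<^sup>T\<close>, which \<open>U\<^sup>T\<close>
  annihilates from the left; the remaining terms start with lower-order corrections, for which
  the claim is already known.
\<close>

lemma transpose_mult_correction:
  fixes U :: "real^'r^'m" and Z :: "real^'r^'n"
  assumes "U\<^sup>T ** U = mat 1"
  shows "U\<^sup>T ** correction j U Z L = 0"
proof -
  note simps = Let_def matrix_diff_ldistrib matrix_mul_assoc transpose_mult_Pperp[OF assms]
  have 1: "U\<^sup>T ** dU1 U Z L = 0"
    by (simp add: dU1_def simps)
  have 2: "U\<^sup>T ** dU2 U Z L = 0"
    by (simp add: dU2_def simps 1)
  have 3: "U\<^sup>T ** dU3 U Z L = 0"
    by (simp add: dU3_def simps 1 2)
  have 4: "U\<^sup>T ** dU4 U Z L = 0"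
    by (simp add: dU4_def simps 1 2 3)
  show ?thesis
    by (simp add: correction_def 1 2 3 4)
qed

lemma transpose_mult_corrected:
  fixes U :: "real^'r^'m" and Z :: "real^'r^'n"
  assumes "U\<^sup>T ** U = mat 1"
  shows "U\<^sup>T ** (U + (\<Sum>j=1..p. dt ^ j *\<^sub>R correction j U Z L)) = mat 1"
proof -
  have "U\<^sup>T ** (\<Sum>j=1..p. dt ^ j *\<^sub>R correction j U Z L) = 0"
    by (induction p)
      (simp_all add: matrix_add_ldistrib matrix_scaleR_right transpose_mult_correction[OF assms])
  then show ?thesis
    by (simp add: matrix_add_ldistrib assms)
qed

theorem lemma2p1:
  fixes X L :: "real^'n^'m" and U :: "real^'r^'m" and Z :: "real^'r^'n"
    and dt :: real and p :: nat
    and orth :: "real^'r^'m \<Rightarrow> real^'r^'m"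
  assumes "X = U ** Z\<^sup>T"
    and "rank X = CARD('r)"
    and "U\<^sup>T ** U = mat 1"
    and "rank Z = CARD('r)"
    and "p \<in> {1, 2, 3, 4}"
    and "is_orth orth"
  shows "norm (opt_retraction orth p U Z dt L) \<le> norm (X + dt *\<^sub>R L)"
proof -
  let ?Q = "next_U orth p U Z dt L"
  have "rank (U + (\<Sum>j=1..p. dt ^ j *\<^sub>R correction j U Z L)) = CARD('r)"
    using transpose_mult_corrected[OF assms(3)] by (rule rank_eq_card_of_left_inverse)
  then have "?Q\<^sup>T ** ?Q = mat 1"
    using assms(6) by (auto simp: is_orth_def next_U_def)
  then have "norm (?Q ** (?Q\<^sup>T ** (X + dt *\<^sub>R L))) \<le> norm (X + dt *\<^sub>R L)"
    by (rule norm_orthonormal_projection_le)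
  moreover have "opt_retraction orth p U Z dt L = ?Q ** (?Q\<^sup>T ** (X + dt *\<^sub>R L))"
    by (simp add: opt_retraction_def next_Z_def matrix_transpose_mul assms(1))
  ultimately show ?thesis
    by simp
qed

end
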